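(* Let $k$ be a field and let $X$ be an indeterminate over $k$. Let $T$ be a local domain with maximal ideal $\mathfrak{m}$ and containing its residue field $k(X) = T/\mathfrak{m}$. Then the ring $D = k + \mathfrak{m}$ is a Strong Bezout Intersection domain.
   Context: "Local" means having a unique maximal ideal (not necessarily Noetherian). "$T$ contains its residue field $k(X)$" means that $T$ has a subfield, identified with $k(X)$, which maps isomorphically onto $T/\mathfrak{m}$ under the quotient map; $k+\mathfrak{m}$ is the subring $\{c+y : c\in k,\ y\in\mathfrak{m}\}$ of $T$. Elements $a_1,\dots,a_n$ ($n\ge 2$) of an integral domain $D$ are pairwise incomparable if $a_i\notin (a_j)$ for all $i\neq j$. An integral domain $D$ is a Strong Bezout Intersection domain (SBID) if for every finite collection of pairwise incomparable elements $a_1,\dots,a_n\in D$ with $n\ge 2$, the ideal $(a_1)\cap\dots\cap(a_n)$ is not finitely generated. *)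

theory Defs
  imports "HOL-Algebra.Algebraic_Closure_Type"
begin

definition local_ring :: "('a, 'b) ring_scheme \<Rightarrow> bool" where
  "local_ring R \<longleftrightarrow> cring R \<and> (\<exists>!M. maximalideal M R)"

text \<open>The field \<open>k(X)\<close> of rational functions over the field given by the type \<open>'k\<close>,
  and its subset of constants, i.e. the copy of \<open>k\<close> inside \<open>k(X)\<close>.\<close>

definition rat_fun_field :: "'k::field poly fract ring" where
  "rat_fun_field = ring_of_type_algebra"

definition rat_fun_consts :: "'k::field poly fract set" where
  "rat_fun_consts = range (\<lambda>c. Fraction_Field.Fract [:c:] 1)"

definition finitely_generated_ideal :: "('a, 'b) ring_scheme \<Rightarrow> 'a set \<Rightarrow> bool" where
  "finitely_generated_ideal R I \<longleftrightarrow>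
     (\<exists>A \<subseteq> carrier R. finite A \<and> I = Idl\<^bsub>R\<^esub> A)"

definition pairwise_incomparable ::
    "('a, 'b) ring_scheme \<Rightarrow> nat \<Rightarrow> (nat \<Rightarrow> 'a) \<Rightarrow> bool" where
  "pairwise_incomparable R n a \<longleftrightarrow>
     (\<forall>i<n. \<forall>j<n. i \<noteq> j \<longrightarrow> a i \<notin> PIdl\<^bsub>R\<^esub> (a j))"

definition SBID :: "('a, 'b) ring_scheme \<Rightarrow> bool" where
  "SBID R \<longleftrightarrow> domain R \<and>
     (\<forall>n a. n \<ge> 2 \<and> (\<forall>i<n. a i \<in> carrier R) \<and> pairwise_incomparable R n a \<longrightarrow>
        \<not> finitely_generated_ideal R (\<Inter>i\<in>{..<n}. PIdl\<^bsub>R\<^esub> (a i)))"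

text \<open>The structure \<open>C + I\<close>, with the operations of \<open>R\<close>.\<close>

definition sum_ring :: "('a, 'b) ring_scheme \<Rightarrow> 'a set \<Rightarrow> 'a set \<Rightarrow> ('a, 'b) ring_scheme" where
  "sum_ring R C I = R\<lparr>carrier := {c \<oplus>\<^bsub>R\<^esub> y | c y. c \<in> C \<and> y \<in> I}\<rparr>"

end

theory Submission
  imports Defs "HOL-Algebra.Ideal_Product"
begin

text \<open>
  Write \<open>D = k + \<mm>\<close>, let \<open>a\<^sub>1, \<dots>, a\<^sub>n\<close> be pairwise incomparable elements of \<open>D\<close> with \<open>n \<ge> 2\<close>,
  and let \<open>I\<close> be the intersection of the ideals they generate in \<open>D\<close>.

  The first point is that \<open>I\<close> is an ideal of the larger ring \<open>T\<close>. Let \<open>z = d\<^sub>i a\<^sub>i\<close> be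
  in \<open>I\<close>. If some \<open>d\<^sub>i\<close> were a unit of \<open>D\<close>, then \<open>a\<^sub>i\<close> would lie in \<open>I\<close>, hence in every \<open>(a\<^sub>j)\<close>,
  against incomparability. Every element of \<open>D\<close> outside \<open>\<mm>\<close> is a unit of \<open>D\<close>
  (\<open>UnitsI_outside_M\<close>), so all \<open>d\<^sub>i\<close> are in \<open>\<mm>\<close>. Since \<open>\<mm>\<close> is an ideal of \<open>T\<close> contained in \<open>D\<close>,
  the elements \<open>t z = (t d\<^sub>i) a\<^sub>i\<close> with \<open>t \<in> T\<close> are in \<open>I\<close> again.

  The second point is that an ideal \<open>I\<close> of \<open>T\<close> contained in \<open>\<mm>\<close> is finitely generated over
  \<open>D\<close> only if it is zero (\<open>finitely_generated_over_D_imp_zero\<close>). The quotient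
  \<open>I / \<mm>I\<close> would be a finite-dimensional vector space over \<open>k = D / \<mm>\<close>, and also a vector
  space over the field \<open>k(X) = T / \<mm>\<close>, which is infinite-dimensional over \<open>k\<close>. So it is zero,
  \<open>I = \<mm>I\<close>, and Nakayama's lemma over the local ring \<open>T\<close> gives \<open>I = 0\<close>. But an
  intersection of finitely many nonzero ideals of a domain is not zero.

  The dimension count is carried out by elimination in \<open>k[X]\<close>. Fix \<open>a \<in> I\<close>. At first all
  polynomials \<open>f\<close> satisfy \<open>f(X) a \<in> \<mm>I + \<Sum> D b\<close>, with \<open>b\<close> ranging over the generators of \<open>I\<close>.
  Dropping one generator replaces the set of such \<open>f\<close> by a \<open>k\<close>-subspace of codimension at
  most one, and such a subspace still contains polynomials of arbitrarily large degree
  (\<open>unbounded_degree_remove_generator\<close>). When no generator is left, some nonconstant \<open>f\<close>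
  has \<open>f(X) a \<in> \<mm>I\<close>. As \<open>f(X)\<close> is a unit of \<open>T\<close>, this puts \<open>a\<close> into \<open>\<mm>I\<close>.
\<close>

section \<open>Local rings and Nakayama's lemma\<close>

text \<open>Zorn's lemma, applied to the ideals above \<open>I\<close> that avoid \<open>\<one>\<close>: a union of a chain of
  such ideals is again one.\<close>

lemma (in cring) exists_maximalideal_above:
  assumes "ideal I R" "I \<noteq> carrier R"
  shows "\<exists>M. maximalideal M R \<and> I \<subseteq> M"
proof -
  define P where "P = {J. ideal J R \<and> I \<subseteq> J \<and> \<one> \<notin> J}"
  have one: "J = carrier R" if "ideal J R" "\<one> \<in> J" for J
    using ideal.one_imp_carrier[OF that] .
  have "\<exists>M\<in>P. \<forall>J\<in>P. M \<subseteq> J \<longrightarrow> J = M"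
  proof (rule subset_Zorn_nonempty)
    show "P \<noteq> {}" using assms one by (auto simp: P_def)
  next
    fix C assume C: "C \<noteq> {}" "subset.chain P C"
    have id: "ideal J R" "I \<subseteq> J" "\<one> \<notin> J" if "J \<in> C" for J
      using C that by (auto simp: P_def subset_chain_def)
    have tot: "J \<subseteq> J' \<or> J' \<subseteq> J" if "J \<in> C" "J' \<in> C" for J J'
      using C that by (auto simp: subset_chain_def)
    have "ideal (\<Union>C) R"
    proof (rule idealI[OF ring_axioms])
      show "subgroup (\<Union>C) (add_monoid R)"
      proof (rule add.subgroupI)
        show "\<Union>C \<subseteq> carrier R"
          using ideal.Icarr[OF id(1)] by (intro Union_least subsetI)
        obtain J where "J \<in> C" using C by blast
        then show "\<Union>C \<noteq> {}"
          using additive_subgroup.zero_closed[OF ideal.axioms(1)[OF id(1)]] by blast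
      next
        fix x assume "x \<in> \<Union>C"
        then obtain J where "J \<in> C" "x \<in> J" by blast
        then show "\<ominus> x \<in> \<Union>C"
          using additive_subgroup.a_inv_closed[OF ideal.axioms(1)[OF id(1)]] by blast
      next
        fix x y assume "x \<in> \<Union>C" "y \<in> \<Union>C"
        then obtain J where "J \<in> C" "x \<in> J" "y \<in> J" using tot by blast
        then show "x \<oplus> y \<in> \<Union>C"
          using additive_subgroup.a_closed[OF ideal.axioms(1)[OF id(1)]] by blast
      qed
    next
      fix a x assume "a \<in> \<Union>C" and x: "x \<in> carrier R"
      then obtain J where J: "J \<in> C" "a \<in> J" by blast
      then show "x \<otimes> a \<in> \<Union>C" "a \<otimes> x \<in> \<Union>C"
        using ideal.I_l_closed[OF id(1) _ x] ideal.I_r_closed[OF id(1) _ x] by blast+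
    qed
    then show "\<Union>C \<in> P" using id C(1) unfolding P_def by blast
  qed
  then obtain M where M: "M \<in> P" and max: "\<And>J. J \<in> P \<Longrightarrow> M \<subseteq> J \<Longrightarrow> J = M" by blast
  have "maximalideal M R"
  proof (rule maximalidealI)
    show "ideal M R" using M by (simp add: P_def)
    show "carrier R \<noteq> M" using M by (auto simp: P_def)
    fix J assume J: "ideal J R" "M \<subseteq> J" "J \<subseteq> carrier R"
    show "J = M \<or> J = carrier R"
    proof (cases "\<one> \<in> J")
      case True then show ?thesis using one J by blast
    next
      case False
      then have "J \<in> P" using J M by (auto simp: P_def)
      then show ?thesis using max J by blast
    qed
  qed
  then show ?thesis using M by (auto simp: P_def)
qed

text \<open>A nonunit generates a proper ideal, and the only maximal ideal that can contain
  this ideal is \<open>M\<close>.\<close>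

lemma (in cring) local_ring_UnitsI:
  assumes "local_ring R" "maximalideal M R" "x \<in> carrier R" "x \<notin> M"
  shows "x \<in> Units R"
proof (rule ccontr)
  assume nu: "x \<notin> Units R"
  have "\<one> \<notin> PIdl x"
  proof
    assume "\<one> \<in> PIdl x"
    then obtain r where "r \<in> carrier R" "r \<otimes> x = \<one>" by (auto simp: cgenideal_def)
    then show False using nu assms(3) m_comm by (auto simp: Units_def)
  qed
  then have "PIdl x \<noteq> carrier R" by auto
  then obtain M' where M': "maximalideal M' R" "PIdl x \<subseteq> M'"
    using exists_maximalideal_above[OF cgenideal_ideal[OF assms(3)]] by blast
  then have "M' = M" using assms(1,2) by (auto simp: local_ring_def)
  then show False using M' cgenideal_self[OF assms(3)] assms(4) by blast
qed

lemma (in cring) genideal_insert: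
  assumes "A \<subseteq> carrier R" "a \<in> carrier R"
  shows "Idl (insert a A) = {r \<otimes> a \<oplus> y | r y. r \<in> carrier R \<and> y \<in> Idl A}"
proof -
  have iA: "ideal (Idl A) R" and ia: "ideal (PIdl a) R"
    using genideal_ideal[OF assms(1)] cgenideal_ideal[OF assms(2)] .
  have sub: "PIdl a \<union> Idl A \<subseteq> carrier R"
    using ideal.Icarr[OF iA] ideal.Icarr[OF ia] by auto
  have "Idl (insert a A) = Idl (PIdl a \<union> Idl A)"
  proof
    have "insert a A \<subseteq> Idl (PIdl a \<union> Idl A)"
      using genideal_self[OF sub] cgenideal_self[OF assms(2)] genideal_self[OF assms(1)] by blast
    then show "Idl (insert a A) \<subseteq> Idl (PIdl a \<union> Idl A)"
      by (rule genideal_minimal[OF genideal_ideal[OF sub]])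
    have i: "ideal (Idl (insert a A)) R" and s: "insert a A \<subseteq> Idl (insert a A)"
      using genideal_ideal[of "insert a A"] genideal_self[of "insert a A"] assms by simp_all
    have "PIdl a \<subseteq> Idl (insert a A)" using cgenideal_minimal[OF i] s by blast
    moreover have "Idl A \<subseteq> Idl (insert a A)" using genideal_minimal[OF i] s by blast
    ultimately show "Idl (PIdl a \<union> Idl A) \<subseteq> Idl (insert a A)"
      using genideal_minimal[OF i] by blast
  qed
  also have "\<dots> = PIdl a <+> Idl A" using union_genideal[OF ia iA] .
  also have "\<dots> = {r \<otimes> a \<oplus> y | r y. r \<in> carrier R \<and> y \<in> Idl A}"
    unfolding set_add_def' cgenideal_def by blast
  finally show ?thesis .
qed

lemma (in cring) genideal_empty: "Idl {} = {\<zero>}"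
  using genideal_minimal[OF zeroideal, of "{}"] genideal_ideal[of "{}"]
    additive_subgroup.zero_closed[OF ideal.axioms(1)[OF genideal_ideal[of "{}"]]] by blast

text \<open>The generators are removed one by one. If \<open>I = M I\<close> and \<open>a\<close> is one of the generators,
  then \<open>a = u \<otimes> a \<oplus> y\<close> with \<open>u \<in> M\<close> and \<open>y\<close> in the ideal of the remaining generators; since
  \<open>\<one> \<ominus> u\<close> is a unit, \<open>a\<close> already lies in that ideal.\<close>

lemma (in cring) nakayama:
  assumes loc: "local_ring R" and M: "maximalideal M R"
    and fin: "finite A" and A: "A \<subseteq> carrier R" and eq: "Idl A \<subseteq> ideal_prod R M (Idl A)"
  shows "Idl A = {\<zero>}"
  using fin A eq
proof (induction A rule: finite_induct)
  case empty
  then show ?case by (simp add: genideal_empty)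
next
  case (insert a A)
  have iM: "ideal M R" using M maximalideal.axioms(1) by blast
  have a: "a \<in> carrier R" and A: "A \<subseteq> carrier R" using insert.prems by auto
  have iA: "ideal (Idl A) R" using genideal_ideal[OF A] .
  interpret J: ideal "Idl A" R by (rule iA)
  \<comment> \<open>the product ideal \<open>M I\<close> is \<open>M a\<close> plus something generated by the other generators\<close>
  have form: "\<exists>u\<in>M. \<exists>y\<in>Idl A. x = u \<otimes> a \<oplus> y" if "x \<in> ideal_prod R M (Idl (insert a A))" for x
    using that
  proof (induction rule: ideal_prod.induct)
    case (prod i j)
    then obtain r y where ry: "r \<in> carrier R" "y \<in> Idl A" "j = r \<otimes> a \<oplus> y"
      using genideal_insert[OF A a] by auto
    have ic: "i \<in> carrier R" and yc: "y \<in> carrier R"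
      using ideal.Icarr[OF iM prod(1)] J.Icarr[OF ry(2)] .
    have "i \<otimes> j = (i \<otimes> r) \<otimes> a \<oplus> i \<otimes> y"
      unfolding ry(3) using ic yc ry(1) a by algebra
    moreover have "i \<otimes> r \<in> M" using ideal.I_r_closed[OF iM prod(1) ry(1)] .
    moreover have "i \<otimes> y \<in> Idl A" using J.I_l_closed[OF ry(2) ic] .
    ultimately show ?case by blast
  next
    case (sum s1 s2)
    then obtain u y u' y' where *: "u \<in> M" "y \<in> Idl A" "s1 = u \<otimes> a \<oplus> y"
      "u' \<in> M" "y' \<in> Idl A" "s2 = u' \<otimes> a \<oplus> y'" by blast
    have c: "u \<in> carrier R" "u' \<in> carrier R" "y \<in> carrier R" "y' \<in> carrier R"
      using * by (simp_all add: ideal.Icarr[OF iM] J.Icarr)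
    have "s1 \<oplus> s2 = (u \<oplus> u') \<otimes> a \<oplus> (y \<oplus> y')"
      unfolding * using c a by algebra
    moreover have "u \<oplus> u' \<in> M" using * by (simp add: additive_subgroup.a_closed[OF ideal.axioms(1)[OF iM]])
    moreover have "y \<oplus> y' \<in> Idl A" using * by (simp add: J.a_closed)
    ultimately show ?case by blast
  qed
  have "a \<in> Idl (insert a A)" using genideal_self[OF insert.prems(1)] by blast
  then obtain u y where uy: "u \<in> M" "y \<in> Idl A" "a = u \<otimes> a \<oplus> y"
    using insert.prems(2) form[of a] by blast
  have uc: "u \<in> carrier R" and yc: "y \<in> carrier R" using ideal.Icarr[OF iM uy(1)] J.Icarr[OF uy(2)] .
  have "\<one> \<ominus> u \<notin> M"
  proof
    assume "\<one> \<ominus> u \<in> M"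
    then have "(\<one> \<ominus> u) \<oplus> u \<in> M"
      using uy(1) by (simp add: additive_subgroup.a_closed[OF ideal.axioms(1)[OF iM]])
    moreover have "(\<one> \<ominus> u) \<oplus> u = \<one>" using uc by algebra
    ultimately have "M = carrier R" using ideal.one_imp_carrier[OF iM] by simp
    then show False using maximalideal.I_notcarr[OF M] by simp
  qed
  then have unit: "\<one> \<ominus> u \<in> Units R" using local_ring_UnitsI[OF loc M] uc by simp
  have "(\<one> \<ominus> u) \<otimes> a = a \<ominus> u \<otimes> a" using uc a by algebra
  also have "\<dots> = (u \<otimes> a \<oplus> y) \<ominus> u \<otimes> a" using uy(3) by simp
  also have "\<dots> = y" using uc a yc by algebra
  finally have "y = (\<one> \<ominus> u) \<otimes> a" ..
  then have "inv (\<one> \<ominus> u) \<otimes> y = a"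
    using unit uc a by (simp add: m_assoc[symmetric] Units_l_inv)
  then have aA: "a \<in> Idl A" using J.I_l_closed[OF uy(2), of "inv (\<one> \<ominus> u)"] unit by simp
  have "Idl (insert a A) = Idl A"
  proof
    show "Idl (insert a A) \<subseteq> Idl A"
      using genideal_minimal[OF iA] aA genideal_self[OF A] by blast
    show "Idl A \<subseteq> Idl (insert a A)"
      using genideal_minimal[OF genideal_ideal[OF insert.prems(1)]]
        genideal_self[OF insert.prems(1)] by blast
  qed
  then show ?case using insert.IH[OF A] insert.prems(2) by simp
qed

section \<open>Finite intersections of ideals in a domain\<close>

text \<open>The product of nonzero elements, one from each ideal, lies in all of them.\<close>

lemma (in domain) nonzero_common_element:
  assumes "finite S" "\<And>i. i \<in> S \<Longrightarrow> ideal (J i) R" "\<And>i. i \<in> S \<Longrightarrow> J i \<noteq> {\<zero>}"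
  shows "\<exists>x\<in>carrier R. x \<noteq> \<zero> \<and> (\<forall>i\<in>S. x \<in> J i)"
  using assms
proof (induction S rule: finite_induct)
  case empty
  then show ?case using one_closed one_not_zero by blast
next
  case (insert i S)
  then obtain x where x: "x \<in> carrier R" "x \<noteq> \<zero>" "\<forall>i\<in>S. x \<in> J i" by auto
  interpret Ji: ideal "J i" R using insert.prems by blast
  obtain y where y: "y \<in> J i" "y \<noteq> \<zero>"
    using insert.prems(2)[of i] Ji.zero_closed by blast
  have yc: "y \<in> carrier R" using y Ji.Icarr by blast
  have "x \<otimes> y \<noteq> \<zero>" using integral x y yc by blast
  moreover have "x \<otimes> y \<in> J j" if "j \<in> insert i S" for j
    using that x y yc insert.prems(1) ideal.I_r_closed ideal.I_l_closed
    by (metis insertE)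
  ultimately show ?case using x yc by blast
qed

section \<open>The ring of constants plus an ideal\<close>

text \<open>The map \<open>\<phi>\<close> is evaluation of polynomials at an element \<open>X\<close> of \<open>R\<close>, and \<open>k\<close> is the image
  of the constants. The elimination argument is linear algebra over \<open>k\<close> with polynomials in \<open>X\<close>
  as vectors; that \<open>X\<close> is transcendental modulo \<open>M\<close> enters only when a nonconstant polynomial
  has to be inverted.\<close>

locale constants_plus_ideal = cring R + M: ideal M R
  for R (structure) and M +
  fixes \<phi> :: "'k::field poly \<Rightarrow> 'a"
  assumes \<phi>_closed [simp]: "\<phi> f \<in> carrier R"
    and \<phi>_one: "\<phi> 1 = \<one>"
    and \<phi>_add: "\<phi> (f + g) = \<phi> f \<oplus> \<phi> g"
    and \<phi>_mult: "\<phi> (f * g) = \<phi> f \<otimes> \<phi> g"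
begin

definition D :: "'a set" where
  "D = {\<phi> [:c:] \<oplus> y | c y. y \<in> M}"

abbreviation S where "S \<equiv> R\<lparr>carrier := D\<rparr>"

lemma \<phi>_zero: "\<phi> 0 = \<zero>"
proof -
  have "\<phi> 0 \<oplus> \<phi> 0 = \<phi> 0 \<oplus> \<zero>" using \<phi>_add[of 0 0] by simp
  then show ?thesis by (metis \<phi>_closed add.l_cancel zero_closed)
qed

lemma \<phi>_uminus: "\<phi> (- f) = \<ominus> \<phi> f"
  using \<phi>_add[of "- f" f] \<phi>_zero by (simp add: minus_equality)

lemma const_mem_D: "\<phi> [:c:] \<in> D"
  unfolding D_def using M.zero_closed by (force intro!: exI[of _ \<zero>])

lemma M_subset_D: "M \<subseteq> D"
  unfolding D_def using M.Icarr \<phi>_zero by (force intro!: exI[of _ 0])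

lemma D_subset_carrier: "D \<subseteq> carrier R"
  unfolding D_def using M.Icarr by auto

lemma subring_D: "subring D R"
proof (rule subringI)
  show "D \<subseteq> carrier R" by (rule D_subset_carrier)
  show "\<one> \<in> D" using const_mem_D[of 1] \<phi>_one by (simp add: one_pCons)
next
  fix x assume "x \<in> D"
  then obtain c y where x: "x = \<phi> [:c:] \<oplus> y" "y \<in> M" by (auto simp: D_def)
  have "\<ominus> x = \<phi> [:- c:] \<oplus> (\<ominus> y)"
    using x M.Icarr \<phi>_uminus[of "[:c:]"] by (simp add: minus_add)
  then show "\<ominus> x \<in> D" using x by (auto simp: D_def)
next
  fix x y assume "x \<in> D" "y \<in> D"
  then obtain c u d v where x: "x = \<phi> [:c:] \<oplus> u" "u \<in> M" and y: "y = \<phi> [:d:] \<oplus> v" "v \<in> M"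
    by (auto simp: D_def)
  have c: "u \<in> carrier R" "v \<in> carrier R" using x y M.Icarr by auto
  have "x \<oplus> y = \<phi> [:c + d:] \<oplus> (u \<oplus> v)"
    unfolding x y using \<phi>_add[of "[:c:]" "[:d:]"] c by (simp add: a_ac)
  then show "x \<oplus> y \<in> D" using x y by (auto simp: D_def)
  have "[:c * d:] = [:c:] * [:d:]" by simp
  then have "\<phi> [:c * d:] = \<phi> [:c:] \<otimes> \<phi> [:d:]" by (simp only: \<phi>_mult)
  then have "x \<otimes> y = \<phi> [:c * d:] \<oplus> (\<phi> [:c:] \<otimes> v \<oplus> u \<otimes> y)"
    unfolding x y using c by (simp add: l_distr r_distr a_ac)
  moreover have "\<phi> [:c:] \<otimes> v \<oplus> u \<otimes> y \<in> M"
    using x y c by (simp add: M.I_l_closed M.I_r_closed)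
  ultimately show "x \<otimes> y \<in> D" by (auto simp: D_def)
qed

lemma cring_D: "cring S"
  using subring_D subcring_iff subcringI' D_subset_carrier by blast

lemma ideal_contraction:
  assumes "ideal J R" shows "ideal (J \<inter> D) S"
proof (rule idealI)
  interpret J: ideal J R by fact
  note sr = subringE[OF subring_D]
  show "ring S" using cring_D cring.axioms(1) by blast
  have "subgroup (J \<inter> D) (add_monoid R)"
    using add.subgroups_Inter_pair[OF J.a_subgroup subring.axioms(1)[OF subring_D]] by simp
  then show "subgroup (J \<inter> D) (add_monoid S)"
    using add.subgroup_incl[OF _ subring.axioms(1)[OF subring_D]] by simp
  fix a x assume "a \<in> J \<inter> D" "x \<in> carrier S"
  then show "x \<otimes>\<^bsub>S\<^esub> a \<in> J \<inter> D" "a \<otimes>\<^bsub>S\<^esub> x \<in> J \<inter> D"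
    using sr(6) D_subset_carrier J.I_l_closed J.I_r_closed by auto
qed

section \<open>Ideals that are finitely generated over the subring\<close>

text \<open>The set of all \<open>f\<close> with \<open>\<phi> f \<otimes> a \<in> N\<close> has codimension at most one in the set of all \<open>f\<close>
  with \<open>\<phi> f \<otimes> a \<in> D b + N\<close>: modulo \<open>N\<close>, the coefficient of \<open>b\<close> matters only through its
  constant part, because \<open>M b\<close> lies in \<open>N\<close>. Take \<open>f\<close> of large degree in the bigger set, and \<open>g\<close>
  there of degree larger still, with constant parts \<open>c\<close> and \<open>d\<close>. Either \<open>c = 0\<close> and \<open>f\<close> works,
  or \<open>c g - d f\<close> works and has the degree of \<open>g\<close>. Unbounded degree thus takes the place of
  infinite dimension.\<close>

lemma unbounded_degree_remove_generator:
  assumes N: "ideal N S" and b: "b \<in> D" and Mb: "\<And>u. u \<in> M \<Longrightarrow> u \<otimes> b \<in> N"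
    and a: "a \<in> carrier R"
    and unb: "\<And>n. \<exists>f. degree f > n \<and> \<phi> f \<otimes> a \<in> Idl\<^bsub>S\<^esub> (insert b N)"
  shows "\<exists>f. degree f > n \<and> \<phi> f \<otimes> a \<in> N"
proof -
  interpret S: cring S by (rule cring_D)
  interpret N: ideal N S by (rule N)
  have ND: "N \<subseteq> D" using N.Icarr by auto
  have IN: "Idl\<^bsub>S\<^esub> N = N"
    using S.genideal_minimal[OF N, of N] S.genideal_self[of N] ND by auto
  have form: "\<exists>c. \<exists>z\<in>N. x = \<phi> [:c:] \<otimes> b \<oplus> z" if "x \<in> Idl\<^bsub>S\<^esub> (insert b N)" for x
  proof -
    have "\<exists>r y. x = r \<otimes> b \<oplus> y \<and> r \<in> D \<and> y \<in> N"
      using that S.genideal_insert[of N b] ND b IN by auto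
    then obtain r y where x: "x = r \<otimes> b \<oplus> y" "r \<in> D" "y \<in> N" by blast
    then obtain c u where r: "r = \<phi> [:c:] \<oplus> u" "u \<in> M" by (auto simp: D_def)
    have cc: "b \<in> carrier R" "u \<in> carrier R" "y \<in> carrier R"
      using b r M.Icarr x ND D_subset_carrier by auto
    have "x = \<phi> [:c:] \<otimes> b \<oplus> (u \<otimes> b \<oplus> y)"
      unfolding x r using cc by (simp add: l_distr a_ac)
    moreover have "u \<otimes> b \<oplus> y \<in> N" using N.a_closed[OF Mb[OF r(2)] x(3)] by simp
    ultimately show ?thesis by blast
  qed
  obtain f where f: "degree f > n" "\<phi> f \<otimes> a \<in> Idl\<^bsub>S\<^esub> (insert b N)" using unb by blast
  obtain g where g: "degree g > degree f" "\<phi> g \<otimes> a \<in> Idl\<^bsub>S\<^esub> (insert b N)" using unb by blast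
  obtain c z where c: "z \<in> N" "\<phi> f \<otimes> a = \<phi> [:c:] \<otimes> b \<oplus> z" using form[OF f(2)] by blast
  obtain d w where d: "w \<in> N" "\<phi> g \<otimes> a = \<phi> [:d:] \<otimes> b \<oplus> w" using form[OF g(2)] by blast
  have cc: "b \<in> carrier R" "w \<in> carrier R" "z \<in> carrier R"
    using b c d ND D_subset_carrier by auto
  show ?thesis
  proof (cases "c = 0")
    case True
    then have "\<phi> f \<otimes> a = z" using c \<phi>_zero cc by simp
    then show ?thesis using f c by auto
  next
    case False
    define h where "h = [:c:] * g + [:- d:] * f"
    have "degree h = degree g"
    proof -
      have "degree ([:- d:] * f) < degree ([:c:] * g)"
        using False g(1) by (simp add: le_less_trans[OF degree_smult_le])
      then show ?thesis unfolding h_def using False degree_add_eq_left by fastforce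
    qed
    have "\<phi> h = \<phi> [:c:] \<otimes> \<phi> g \<oplus> (\<ominus> \<phi> [:d:]) \<otimes> \<phi> f"
      unfolding h_def using \<phi>_uminus[of "[:d:]"] by (simp only: \<phi>_add \<phi>_mult) simp
    then have "\<phi> h \<otimes> a = \<phi> [:c:] \<otimes> (\<phi> g \<otimes> a) \<oplus> (\<ominus> \<phi> [:d:]) \<otimes> (\<phi> f \<otimes> a)"
      using a by (simp add: l_distr m_assoc)
    also have "\<dots> = \<phi> [:c:] \<otimes> (\<phi> [:d:] \<otimes> b \<oplus> w) \<oplus> (\<ominus> \<phi> [:d:]) \<otimes> (\<phi> [:c:] \<otimes> b \<oplus> z)"
      using c d by simp
    also have "\<dots> = \<phi> [:c:] \<otimes> w \<oplus> (\<ominus> \<phi> [:d:]) \<otimes> z"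
      using cc \<phi>_closed[of "[:c:]"] \<phi>_closed[of "[:d:]"] by algebra
    also have "\<dots> = \<phi> [:c:] \<otimes> w \<oplus> \<phi> [:- d:] \<otimes> z"
      using \<phi>_uminus[of "[:d:]"] by simp
    also have "\<dots> \<in> N"
      using N.a_closed N.I_l_closed c(1) d(1) const_mem_D by simp
    finally have "\<phi> h \<otimes> a \<in> N" .
    moreover have "degree h > n" using \<open>degree h = degree g\<close> f(1) g(1) by linarith
    ultimately show ?thesis by blast
  qed
qed

lemma unbounded_degree_remove_generators:
  assumes N: "ideal N S" and "finite B" "B \<subseteq> D"
    and "\<And>u b. u \<in> M \<Longrightarrow> b \<in> B \<Longrightarrow> u \<otimes> b \<in> N"
    and a: "a \<in> carrier R"
    and "\<And>n. \<exists>f. degree f > n \<and> \<phi> f \<otimes> a \<in> Idl\<^bsub>S\<^esub> (B \<union> N)"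
  shows "\<exists>f. degree f > n \<and> \<phi> f \<otimes> a \<in> N"
  using assms(2-4,6)
proof (induction B arbitrary: n rule: finite_induct)
  case empty
  interpret S: cring S by (rule cring_D)
  show ?case
    using empty(3) S.genideal_minimal[OF N, of N] by auto
next
  case (insert b B)
  interpret S: cring S by (rule cring_D)
  have ND: "N \<subseteq> D" using ideal.Icarr[OF N] by auto
  have sub: "B \<union> N \<subseteq> carrier S" using ND insert.prems by auto
  \<comment> \<open>drop \<open>b\<close> while keeping the generators in \<open>B\<close> as part of the target ideal\<close>
  let ?N = "Idl\<^bsub>S\<^esub> (B \<union> N)"
  have iN: "ideal ?N S" using S.genideal_ideal[OF sub] .
  have self: "B \<union> N \<subseteq> ?N" using S.genideal_self[OF sub] .
  have sub2: "insert b ?N \<subseteq> carrier S" using ideal.Icarr[OF iN] insert.prems(1) by auto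
  have "insert b B \<union> N \<subseteq> Idl\<^bsub>S\<^esub> (insert b ?N)"
    using self S.genideal_self[OF sub2] by auto
  then have "Idl\<^bsub>S\<^esub> (insert b B \<union> N) \<subseteq> Idl\<^bsub>S\<^esub> (insert b ?N)"
    by (rule S.genideal_minimal[OF S.genideal_ideal[OF sub2]])
  then have unb: "\<exists>f. degree f > n \<and> \<phi> f \<otimes> a \<in> Idl\<^bsub>S\<^esub> (insert b ?N)" for n
    using insert.prems(3)[of n] by (meson subsetD)
  have "\<exists>f. degree f > n \<and> \<phi> f \<otimes> a \<in> ?N" for n
  proof (rule unbounded_degree_remove_generator[OF iN _ _ a unb])
    show "b \<in> D" using insert.prems by simp
    show "u \<otimes> b \<in> ?N" if "u \<in> M" for u
      using insert.prems(2)[OF that, of b] self by blast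
  qed
  then show ?case using insert.IH insert.prems by simp
qed

text \<open>Elimination, started from all generators of \<open>I\<close> and with \<open>N = M I\<close>, shows that \<open>I = M I\<close>;
  Nakayama's lemma applies because generators of \<open>I\<close> over \<open>D\<close> also generate it over \<open>R\<close>.\<close>

lemma finitely_generated_over_D_imp_zero:
  assumes loc: "local_ring R" and max: "maximalideal M R"
    and transc: "\<And>f. degree f > 0 \<Longrightarrow> \<phi> f \<notin> M"
    and I: "ideal I R" "I \<subseteq> M" and A: "finite A" "A \<subseteq> D" "I = Idl\<^bsub>S\<^esub> A"
  shows "I = {\<zero>}"
proof -
  interpret S: cring S by (rule cring_D)
  interpret I: ideal I R by (rule I(1))
  have AR: "A \<subseteq> carrier R" using A(2) D_subset_carrier by blast
  have AI: "A \<subseteq> I" using A S.genideal_self by simp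
  have ID: "I \<subseteq> D" using I(2) M_subset_D by blast
  let ?MI = "ideal_prod R M I"
  have iMI: "ideal ?MI R" by (rule ideal_prod_is_ideal[OF M.is_ideal I(1)])
  have MI_I: "?MI \<subseteq> I" using ideal_prod_inter[OF M.is_ideal I(1)] by blast
  have iMI_S: "ideal ?MI S"
    using ideal_contraction[OF iMI] MI_I ID by (simp add: Int_absorb2 subset_trans)
  have "a \<in> ?MI" if a: "a \<in> I" for a
  proof -
    have ac: "a \<in> carrier R" using a by (rule I.Icarr)
    have sub: "A \<union> ?MI \<subseteq> carrier S" using AI MI_I ID by auto
    have "I \<subseteq> Idl\<^bsub>S\<^esub> (A \<union> ?MI)"
      unfolding A(3) using S.genideal_minimal[OF S.genideal_ideal[OF sub]] S.genideal_self[OF sub]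
      using A(3) by simp
    moreover have "\<phi> f \<otimes> a \<in> I" for f using a by (simp add: I.I_l_closed)
    ultimately have *: "\<phi> f \<otimes> a \<in> Idl\<^bsub>S\<^esub> (A \<union> ?MI)" for f by blast
    have "\<exists>f. degree f > n \<and> \<phi> f \<otimes> a \<in> Idl\<^bsub>S\<^esub> (A \<union> ?MI)" for n
      using * by (intro exI[of _ "Polynomial.monom 1 (Suc n)"]) (simp add: degree_monom_eq)
    then obtain f where f: "degree f > 0" "\<phi> f \<otimes> a \<in> ?MI"
      using unbounded_degree_remove_generators[OF iMI_S A(1,2) _ ac] ideal_prod.prod[of _ M _ I R] AI
      by (metis subsetD)
    have u: "\<phi> f \<in> Units R" using local_ring_UnitsI[OF loc max] transc[OF f(1)] by simp
    have "inv (\<phi> f) \<otimes> (\<phi> f \<otimes> a) = a" using u ac by (simp add: m_assoc[symmetric])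
    then show ?thesis using ideal.I_l_closed[OF iMI f(2), of "inv (\<phi> f)"] u by simp
  qed
  then have sub: "I \<subseteq> ?MI" by blast
  \<comment> \<open>the ideal generated over \<open>R\<close> meets \<open>D\<close> in an ideal of \<open>D\<close> that contains \<open>A\<close>, hence \<open>I\<close>\<close>
  have gen: "Idl A = I"
  proof
    show "Idl A \<subseteq> I" using genideal_minimal[OF I(1) AI] .
    have "ideal (Idl A \<inter> D) S" by (rule ideal_contraction[OF genideal_ideal[OF AR]])
    then show "I \<subseteq> Idl A"
      using S.genideal_minimal[of "Idl A \<inter> D" A] genideal_self[OF AR] A by simp
  qed
  show ?thesis using nakayama[OF loc max A(1) AR] sub gen by simp
qed

section \<open>Intersections of principal ideals of the subring\<close>

text \<open>Write \<open>x = c + y\<close> with a constant \<open>c\<close>, nonzero because \<open>x\<close> is not in \<open>M\<close>, and \<open>y\<close> in \<open>M\<close>.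
  The inverse of \<open>x\<close> exists in the local ring \<open>R\<close>; multiplying \<open>x \<otimes> inv x = \<one>\<close> by the inverse
  of \<open>c\<close> shows that \<open>inv x\<close> and the inverse of \<open>c\<close> differ by an element of \<open>M\<close>.\<close>

lemma UnitsI_outside_M:
  assumes loc: "local_ring R" and max: "maximalideal M R" and x: "x \<in> D" "x \<notin> M"
  shows "x \<in> Units S"
proof -
  obtain c y where cy: "x = \<phi> [:c:] \<oplus> y" "y \<in> M" using x by (auto simp: D_def)
  have c: "c \<noteq> 0" using cy x \<phi>_zero M.Icarr by auto
  have xc: "x \<in> carrier R" and yc: "y \<in> carrier R"
    using x D_subset_carrier cy M.Icarr by auto
  have u: "x \<in> Units R" using local_ring_UnitsI[OF loc max xc x(2)] .
  have vc: "inv x \<in> carrier R" using u by simp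
  let ?e = "\<phi> [:inverse c:]"
  have e: "?e \<otimes> \<phi> [:c:] = \<one>"
    using c \<phi>_mult[of "[:inverse c:]" "[:c:]"] \<phi>_one by (simp add: one_pCons)
  have "?e = ?e \<otimes> (x \<otimes> inv x)" using u by simp
  also have "\<dots> = (?e \<otimes> \<phi> [:c:]) \<otimes> inv x \<oplus> ?e \<otimes> y \<otimes> inv x"
    unfolding cy(1)[THEN arg_cong, of "\<lambda>t. t \<otimes> inv x"] using yc vc
    by (simp add: l_distr r_distr m_assoc)
  also have "\<dots> = inv x \<oplus> ?e \<otimes> y \<otimes> inv x" using e vc by simp
  finally have "inv x = ?e \<oplus> \<ominus> (?e \<otimes> y \<otimes> inv x)"
    using yc vc by (metis \<phi>_closed a_minus_def add.inv_solve_right m_closed)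
  moreover have "\<ominus> (?e \<otimes> y \<otimes> inv x) \<in> M"
    using cy vc by (simp add: M.I_l_closed M.I_r_closed)
  ultimately have "inv x \<in> D" unfolding D_def by blast
  moreover have "inv x \<otimes> x = \<one>" "x \<otimes> inv x = \<one>" using u by simp_all
  ultimately show ?thesis using x by (auto simp: Units_def)
qed

text \<open>The intersection of the principal ideals is an ideal of \<open>R\<close> inside \<open>M\<close>, so it would have
  to be zero if it were finitely generated; in a domain it is not.\<close>

lemma SBID_D:
  assumes dom: "domain R" and loc: "local_ring R" and max: "maximalideal M R"
    and transc: "\<And>f. degree f > 0 \<Longrightarrow> \<phi> f \<notin> M"
  shows "SBID S"
  unfolding SBID_def
proof (intro conjI allI impI notI)
  show "domain S" using domain.subring_is_domain[OF dom subring_D] .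
  interpret S: domain S by fact
  fix n :: nat and a
  assume H: "n \<ge> 2 \<and> (\<forall>i<n. a i \<in> carrier S) \<and> pairwise_incomparable S n a"
  let ?I = "\<Inter>i\<in>{..<n}. PIdl\<^bsub>S\<^esub> (a i)"
  assume "finitely_generated_ideal S ?I"
  then obtain A where A: "A \<subseteq> carrier S" "finite A" "?I = Idl\<^bsub>S\<^esub> A"
    by (auto simp: finitely_generated_ideal_def)
  have aD: "a i \<in> D" if "i < n" for i using H that by simp
  have aR: "a i \<in> carrier R" if "i < n" for i using aD[OF that] D_subset_carrier by blast
  have other: "\<exists>j<n. a i \<notin> PIdl\<^bsub>S\<^esub> (a j)" if "i < n" for i
  proof -
    have "\<exists>j<n. i \<noteq> j" using H by (intro exI[of _ "if i = 0 then 1 else 0"]) auto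
    then show ?thesis using H that unfolding pairwise_incomparable_def by blast
  qed
  have idl: "ideal (PIdl\<^bsub>S\<^esub> (a i)) S" if "i < n" for i using S.cgenideal_ideal aD that by simp
  have a0: "a i \<noteq> \<zero>" if i: "i < n" for i
  proof
    assume "a i = \<zero>"
    obtain j where "j < n" "a i \<notin> PIdl\<^bsub>S\<^esub> (a j)" using other i by blast
    then show False
      using additive_subgroup.zero_closed[OF ideal.axioms(1)[OF idl]] \<open>a i = \<zero>\<close> by fastforce
  qed
  \<comment> \<open>a unit as cofactor would put \<open>a i\<close> into all the other principal ideals\<close>
  have cofactor: "\<exists>d\<in>M. z = d \<otimes> a i" if z: "z \<in> ?I" and i: "i < n" for z i
  proof -
    obtain d where d: "d \<in> D" "z = d \<otimes> a i" using z i by (auto simp: cgenideal_def)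
    have "d \<in> M"
    proof (rule ccontr)
      assume "d \<notin> M"
      then have u: "d \<in> Units S" using UnitsI_outside_M[OF loc max] d by blast
      obtain j where j: "j < n" "a i \<notin> PIdl\<^bsub>S\<^esub> (a j)" using other i by blast
      have "a i \<in> carrier S" using aD[OF i] by simp
      then have "inv\<^bsub>S\<^esub> d \<otimes>\<^bsub>S\<^esub> (d \<otimes>\<^bsub>S\<^esub> a i) = a i"
        using u by (simp only: S.m_assoc[symmetric] S.Units_closed S.Units_inv_closed S.Units_l_inv S.l_one)
      moreover have "d \<otimes>\<^bsub>S\<^esub> a i \<in> PIdl\<^bsub>S\<^esub> (a j)" using z j d by auto
      ultimately have "a i \<in> PIdl\<^bsub>S\<^esub> (a j)"
        using ideal.I_l_closed[OF idl[OF j(1)]] u S.Units_inv_closed by metis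
      then show False using j by blast
    qed
    then show ?thesis using d by blast
  qed
  \<comment> \<open>closure under multiplication by all of \<open>R\<close>, since \<open>M\<close> absorbs \<open>R\<close> and lies in \<open>D\<close>\<close>
  have mult: "t \<otimes> z \<in> ?I" if t: "t \<in> carrier R" and z: "z \<in> ?I" for t z
  proof
    fix i assume "i \<in> {..<n}"
    then have i: "i < n" by simp
    obtain d where d: "d \<in> M" "z = d \<otimes> a i" using cofactor[OF z i] by blast
    have "t \<otimes> z = (t \<otimes> d) \<otimes> a i" using d t aR[OF i] M.Icarr by (simp add: m_assoc)
    moreover have "t \<otimes> d \<in> D" using M.I_l_closed[OF d(1) t] M_subset_D by blast
    ultimately show "t \<otimes> z \<in> PIdl\<^bsub>S\<^esub> (a i)" by (auto simp: cgenideal_def)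
  qed
  have n: "0 < n" using H by simp
  have I_M: "?I \<subseteq> M"
  proof
    fix z assume "z \<in> ?I"
    then obtain d where "d \<in> M" "z = d \<otimes> a 0" using cofactor n by blast
    then show "z \<in> M" using aR[OF n] by (simp add: M.I_r_closed)
  qed
  have "ideal ?I R"
  proof (rule idealI[OF ring_axioms])
    show "subgroup ?I (add_monoid R)"
    proof (rule add.subgroupI)
      show "?I \<subseteq> carrier R" using I_M M.Icarr by blast
      have "\<zero> \<in> PIdl\<^bsub>S\<^esub> (a i)" if "i < n" for i
        using additive_subgroup.zero_closed[OF ideal.axioms(1)[OF idl[OF that]]] by simp
      then show "?I \<noteq> {}" by blast
    next
      fix z assume z: "z \<in> ?I"
      have "z \<in> carrier R" using z I_M M.Icarr by blast
      then have "\<ominus> z = (\<ominus> \<one>) \<otimes> z" by (simp add: l_minus)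
      then show "\<ominus> z \<in> ?I" using mult[OF _ z, of "\<ominus> \<one>"] by simp
    next
      fix z w assume "z \<in> ?I" "w \<in> ?I"
      then show "z \<oplus> w \<in> ?I"
        using additive_subgroup.a_closed[OF ideal.axioms(1)[OF idl]] by fastforce
    qed
  next
    fix z t assume z: "z \<in> ?I" and t: "t \<in> carrier R"
    show "t \<otimes> z \<in> ?I" by (rule mult[OF t z])
    moreover have "z \<in> carrier R" using z I_M M.Icarr by blast
    ultimately show "z \<otimes> t \<in> ?I" using t m_comm by simp
  qed
  then have I0: "?I = {\<zero>}"
    using finitely_generated_over_D_imp_zero[OF loc max transc _ I_M A(2) _ A(3)] A(1) by simp
  have "PIdl\<^bsub>S\<^esub> (a i) \<noteq> {\<zero>\<^bsub>S\<^esub>}" if "i < n" for i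
    using S.cgenideal_self[of "a i"] aD[OF that] a0[OF that] by auto
  then obtain x where "x \<noteq> \<zero>" "\<forall>i\<in>{..<n}. x \<in> PIdl\<^bsub>S\<^esub> (a i)"
    using S.nonzero_common_element[of "{..<n}" "\<lambda>i. PIdl\<^bsub>S\<^esub> (a i)"] idl by auto
  then show False using I0 by blast
qed

end

section \<open>Strong Bezout Intersection domains from local domains\<close>

theorem theorem2p5:
  fixes T :: "('t, 'b) ring_scheme"
    and \<mm> K :: "'t set"
    and \<iota> :: "'k::field poly fract \<Rightarrow> 't"
  assumes "domain T"
    and "local_ring T"
    and "maximalideal \<mm> T"
    and "subfield K T"
    and "\<iota> \<in> ring_iso rat_fun_field (T\<lparr>carrier := K\<rparr>)"
    and "(\<lambda>x. \<mm> +>\<^bsub>T\<^esub> x) \<in> ring_iso (T\<lparr>carrier := K\<rparr>) (T Quot \<mm>)"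
  shows "SBID (sum_ring T (\<iota> ` rat_fun_consts) \<mm>)"
proof -
  interpret T: domain T by fact
  interpret max: maximalideal \<mm> T by fact
  note h = ring_iso_memE[OF assms(5)]
  note rf = rat_fun_field_def ring_of_type_algebra_def
  have KT: "K \<subseteq> carrier T"
    using subringE(1)[OF subcring.axioms(1)[OF subdomain.axioms(1)[OF subfield.axioms(1)[OF assms(4)]]]] .
  have \<iota>_closed: "\<iota> x \<in> carrier T" for x using h(1)[of x] KT by (auto simp: rf)
  have \<iota>_mult: "\<iota> (x * y) = \<iota> x \<otimes>\<^bsub>T\<^esub> \<iota> y" for x y using h(2)[of x y] by (simp add: rf)
  have \<iota>_add: "\<iota> (x + y) = \<iota> x \<oplus>\<^bsub>T\<^esub> \<iota> y" for x y using h(3)[of x y] by (simp add: rf)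
  have \<iota>_one: "\<iota> 1 = \<one>\<^bsub>T\<^esub>" using h(4) by (simp add: rf)
  define \<phi> where "\<phi> f = \<iota> (Fraction_Field.Fract f 1)" for f :: "'k poly"
  interpret constants_plus_ideal T \<mm> \<phi>
    by unfold_locales
      (simp_all add: \<phi>_def \<iota>_closed flip: \<iota>_mult \<iota>_add \<iota>_one One_fract_def)
  \<comment> \<open>a nonzero polynomial is invertible in \<open>k(X)\<close>, so its image is a unit of \<open>T\<close>\<close>
  have "\<phi> f \<notin> \<mm>" if "degree f > 0" for f
  proof
    assume f: "\<phi> f \<in> \<mm>"
    let ?g = "Fraction_Field.Fract f 1"
    have "f \<noteq> 0" using that by auto
    then have "?g * Fraction_Field.Fract 1 f = 1" by (simp add: One_fract_def eq_fract)
    then have "\<phi> f \<otimes>\<^bsub>T\<^esub> \<iota> (Fraction_Field.Fract 1 f) = \<one>\<^bsub>T\<^esub>"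
      unfolding \<phi>_def by (metis \<iota>_mult \<iota>_one)
    then have "\<one>\<^bsub>T\<^esub> \<in> \<mm>" using max.I_r_closed[OF f \<iota>_closed] by metis
    then show False using max.one_imp_carrier max.I_notcarr by blast
  qed
  then have "SBID (T\<lparr>carrier := D\<rparr>)" using SBID_D assms(1-3) by blast
  moreover have "T\<lparr>carrier := D\<rparr> = sum_ring T (\<iota> ` rat_fun_consts) \<mm>"
    unfolding sum_ring_def D_def rat_fun_consts_def \<phi>_def
    by (rule arg_cong[of _ _ "\<lambda>C. T\<lparr>carrier := C\<rparr>"]) blast
  ultimately show ?thesis by simp
qed

end
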